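(* Let $n\ge 2$, $\sigma>0$, $\mathbf f\in\mathbb R^n$, and let $\mathbf Y=\mathbf f+\sigma\boldsymbol\varepsilon$, where $\boldsymbol\varepsilon$ is a standard Gaussian vector in $\mathbb R^n$; write $\mathbb P_{\mathbf f,\sigma}$ for the law of $\mathbf Y$. Let $\alpha\in]0,1/2[$. Let $\mathbf v_1,\dots,\mathbf v_p\in\mathbb R^n$ be linearly independent, and set $$\mathcal C=\{\mathbf f\in\mathbb R^n:\ \langle \mathbf f,\mathbf v_j\rangle\le 0\ \text{for all } j=1,\dots,p\},\qquad \mathcal T=\Big\{\mathbf t=\sum_{j=1}^p\lambda_j\mathbf v_j:\ \|\mathbf t\|=1,\ \lambda_j\ge 0\ \forall j\Big\}.$$ Let $\mathcal T_n$ be a finite subset of $\mathcal T$, and let $V_n$ be a linear subspace of $\mathbb R^n$ of dimension $d_n<n$ containing the linear span of $\mathcal T_n$. Let $\{q_{\mathbf t}(\alpha),\ \mathbf t\in\mathcal T_n\}$ be real numbers satisfying $$\mathbb P\Big[\sup_{\mathbf t\in\mathcal T_n}\Big(\sqrt{n-d_n}\,\frac{\langle\boldsymbol\varepsilon,\mathbf t\rangle}{\|\boldsymbol\varepsilon-\Pi_{V_n}\boldsymbol\varepsilon\|}-q_{\mathbf t}(\alpha)\Big)>0\Big]=\alpha,$$ and define the test statistic $$T_\alpha=\sup_{\mathbf t\in\mathcal T_n}\Big(\sqrt{n-d_n}\,\frac{\langle\mathbf Y,\mathbf t\rangle}{\|\mathbf Y-\Pi_{V_n}\mathbf Y\|}-q_{\mathbf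 t}(\alpha)\Big).$$ Then $$\sup_{\sigma>0}\ \sup_{\mathbf f\in\mathcal C}\ \mathbb P_{\mathbf f,\sigma}(T_\alpha>0)=\mathbb P_{0,1}(T_\alpha>0)=\alpha.$$ Moreover, for every $\beta\in]0,1[$, $\mathbf f\in\mathbb R^n$ and $\sigma>0$, if there exists $\mathbf t\in\mathcal T_n$ such that $\langle\mathbf f,\mathbf t\rangle\ge v_{\mathbf t}(\mathbf f,\beta)$, where $$v_{\mathbf t}(\mathbf f,\beta)=\Big(q_{\mathbf t}(\alpha)\frac{1}{\sqrt{n-d_n}}\sqrt{\bar\chi^{-1}_{n-d_n,\|\mathbf f-\Pi_{V_n}\mathbf f\|^2/\sigma^2}(\beta/2)}+\bar\Phi^{-1}(\beta/2)\Big)\sigma,$$ then $\mathbb P_{\mathbf f,\sigma}(T_\alpha>0)\ge 1-\beta$.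
   Context: $\langle\cdot,\cdot\rangle$ and $\|\cdot\|$ are the Euclidean inner product and norm on $\mathbb R^n$; $\Pi_V$ is the orthogonal projection onto a linear subspace $V$. For $u\in[0,1]$, $\bar\Phi^{-1}(u)$ denotes the $1-u$ quantile of a standard Gaussian variable, and $\bar\chi^{-1}_{D,a^2}(u)$ the $1-u$ quantile of a noncentral $\chi^2$ variable with $D$ degrees of freedom and noncentrality parameter $a^2$. $\mathbb P_{0,1}$ is the law with $\mathbf f=0$, $\sigma=1$. *)

theory Defs
  imports "HOL-Probability.Probability"
begin

definition std_gauss :: "'a::euclidean_space measure" where
  "std_gauss = density lborel
     (\<lambda>x. ennreal ((2 * pi) powr (- real DIM('a) / 2) * exp (- (norm x)\<^sup>2 / 2)))"

definition gauss_law :: "'a::euclidean_space \<Rightarrow> real \<Rightarrow> 'a measure" where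
  "gauss_law f \<sigma> = distr std_gauss borel (\<lambda>e. f + \<sigma> *\<^sub>R e)"

definition orth_proj :: "'a::euclidean_space set \<Rightarrow> 'a \<Rightarrow> 'a" where
  "orth_proj V x = (THE y. y \<in> V \<and> (\<forall>v\<in>V. (x - y) \<bullet> v = 0))"

definition std_normal_measure :: "real measure" where
  "std_normal_measure = density lborel (\<lambda>x. ennreal (std_normal_density x))"

text \<open>Noncentral chi-square law with D degrees of freedom and noncentrality a2 = a^2:
  law of sum_{i<D} (Z_i + mu_i)^2 with Z_i iid standard normal and mu = (a,0,...,0).\<close>
definition nc_chi2 :: "nat \<Rightarrow> real \<Rightarrow> real measure" where
  "nc_chi2 D a2 = distr (PiM {..<D} (\<lambda>_. std_normal_measure)) borel
     (\<lambda>z. \<Sum>i<D. (z i + (if i = 0 then sqrt a2 else 0))\<^sup>2)"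

definition upper_quantile :: "real measure \<Rightarrow> real \<Rightarrow> real" where
  "upper_quantile M u = Inf {x. measure M {..x} \<ge> 1 - u}"

definition T_stat :: "'a::euclidean_space set \<Rightarrow> 'a set \<Rightarrow> ('a \<Rightarrow> real) \<Rightarrow> 'a \<Rightarrow> real" where
  "T_stat V Tn q y = Max ((\<lambda>t. sqrt (real (DIM('a) - dim V)) * (y \<bullet> t) / norm (y - orth_proj V y)
                              - q t) ` Tn)"

end

theory Submission
  imports Defs
begin

text \<open>
  Since \<open>\<alpha> < 1/2\<close>, symmetry of the Gaussian law forces every \<open>q t\<close> to be positive.  For the level, dropping
  the nonpositive terms \<open>f \<bullet> t\<close> leaves the event that \<open>\<parallel>P e + g\<parallel>\<close> is smaller than a function of the
  component of \<open>e\<close> in \<open>V\<close>, where \<open>P\<close> projects onto the orthogonal complement of \<open>V\<close> and \<open>g = P f / \<sigma>\<close>.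
  The affine isometry that fixes the component in \<open>V\<close> and maps \<open>P e\<close> to \<open>- g - P e\<close> exchanges this event
  with the one for \<open>g = 0\<close>, and it decreases the norm on the part that does not lie in both; so the shift by
  \<open>g\<close> can only lower the Gaussian probability.  The power estimate is a union bound, based on the laws of
  \<open>e \<bullet> t\<close> and \<open>\<parallel>P e + g\<parallel>\<^sup>2\<close>, which follow from rotation invariance.
\<close>

section \<open>Orthogonal invariance of Lebesgue measure and of the Gaussian law\<close>

lemma nn_integral_lborel_translate:
  fixes f :: "'a::euclidean_space \<Rightarrow> ennreal"
  assumes [measurable]: "f \<in> borel_measurable borel"
  shows "(\<integral>\<^sup>+x. f (x + a) \<partial>lborel) = (\<integral>\<^sup>+x. f x \<partial>lborel)"
proof -
  have "(\<integral>\<^sup>+x. f x \<partial>lborel) = (\<integral>\<^sup>+x. f x \<partial>distr lborel borel ((+) a))"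
    by (simp add: lborel_distr_plus)
  also have "\<dots> = (\<integral>\<^sup>+x. f (a + x) \<partial>lborel)"
    by (rule nn_integral_distr) auto
  finally show ?thesis by (simp add: add.commute)
qed

lemma orthogonal_transformation_borel_measurable:
  fixes F :: "'a::euclidean_space \<Rightarrow> 'a"
  assumes "orthogonal_transformation F"
  shows "F \<in> borel_measurable borel"
  using orthogonal_transformation_linear[OF assms]
  by (intro borel_measurable_continuous_onI linear_continuous_on) (simp add: linear_conv_bounded_linear)

text \<open>
  The uniqueness argument for Haar measure: Fubini applied to \<open>1\<^sub>B y * 1\<^sub>A (F x + y)\<close>, with \<open>B\<close> the unit
  ball, which \<open>F\<close> preserves.
\<close>
lemma distr_lborel_orthogonal:
  fixes F :: "'a::euclidean_space \<Rightarrow> 'a"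
  assumes F: "orthogonal_transformation F"
  shows "distr lborel borel F = lborel"
proof (rule measure_eqI)
  show "sets (distr lborel borel F) = sets (lborel :: 'a measure)" by simp
  fix A assume "A \<in> sets (distr lborel borel F)"
  then have A[measurable]: "A \<in> sets borel" by simp
  have lin: "linear F" using F by (rule orthogonal_transformation_linear)
  note orthogonal_transformation_borel_measurable[OF F, measurable]
  \<comment> \<open>\<open>G y\<close> is a preimage of \<open>y\<close>, so
    \<open>F x + y = F (x + G y)\<close>: a translation after \<open>F\<close> becomes a translation
    before it, which Lebesgue integrals ignore.\<close>
  obtain G where G: "\<And>y. F (G y) = y"
    using orthogonal_transformation_surj[OF F] by (metis surjD)
  define B where "B = ball (0::'a) 1"
  have [measurable]: "B \<in> sets borel" by (simp add: B_def)
  have eq: "(\<integral>\<^sup>+y. (\<integral>\<^sup>+x. indicator B y * indicator A (F x + y) \<partial>lborel) \<partial>lborel) =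
      (\<integral>\<^sup>+x. (\<integral>\<^sup>+y. indicator B y * (indicator A (F x + y) :: ennreal) \<partial>lborel) \<partial>(lborel :: 'a measure))"
    by (rule lborel_pair.Fubini') simp
  have "(\<integral>\<^sup>+x. indicator B y * indicator A (F x + y) \<partial>lborel) =
        (indicator B y :: ennreal) * emeasure (distr lborel borel F) A" for y
  proof -
    have "(\<integral>\<^sup>+x. indicator A (F x + y) \<partial>lborel) = (\<integral>\<^sup>+x. (indicator A (F (x + G y)) :: ennreal) \<partial>lborel)"
      by (simp add: linear_add[OF lin] G)
    also have "\<dots> = (\<integral>\<^sup>+x. indicator A (F x) \<partial>lborel)"
      by (rule nn_integral_lborel_translate[where f = "\<lambda>x. indicator A (F x)"]) simp
    also have "\<dots> = (\<integral>\<^sup>+x. indicator A x \<partial>distr lborel borel F)"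
      by (subst nn_integral_distr) simp_all
    also have "\<dots> = emeasure (distr lborel borel F) A" by simp
    finally have "(\<integral>\<^sup>+x. indicator A (F x + y) \<partial>lborel) = emeasure (distr lborel borel F) A" .
    then show ?thesis by (subst nn_integral_cmult) simp_all
  qed
  then have L: "(\<integral>\<^sup>+y. (\<integral>\<^sup>+x. indicator B y * indicator A (F x + y) \<partial>lborel) \<partial>lborel) =
      emeasure lborel B * emeasure (distr lborel borel F) A"
    by (simp add: nn_integral_multc)
  have "(\<integral>\<^sup>+y. indicator B y * (indicator A (F x + y) :: ennreal) \<partial>lborel) =
      (\<integral>\<^sup>+y. indicator B (y - F x) * indicator A y \<partial>lborel)" for x
    using nn_integral_lborel_translate[of "\<lambda>y. indicator B (y - F x) * indicator A y" "F x"]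
    by (simp add: add.commute)
  then have "(\<integral>\<^sup>+x. (\<integral>\<^sup>+y. indicator B y * (indicator A (F x + y) :: ennreal) \<partial>lborel) \<partial>(lborel :: 'a measure))
      = (\<integral>\<^sup>+y. (\<integral>\<^sup>+x. indicator B (y - F x) * indicator A y \<partial>lborel) \<partial>lborel)"
    using lborel_pair.Fubini'[of "\<lambda>y x. indicator B (y - F x) * indicator A y :: ennreal"] by simp
  also have "\<dots> = (\<integral>\<^sup>+y. emeasure lborel B * indicator A y \<partial>lborel)"
  proof (rule nn_integral_cong)
    fix y :: 'a
    have "(\<integral>\<^sup>+x. indicator B (y - F x) \<partial>lborel) = (\<integral>\<^sup>+x. indicator B (y - F (x + G y)) \<partial>(lborel :: 'a measure))"
      by (rule nn_integral_lborel_translate[where f = "\<lambda>x. indicator B (y - F x)", symmetric]) simp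
    \<comment> \<open>After the shift the argument is \<open>- F x\<close>, whose norm is that of
      \<open>x\<close>; the centred ball \<open>B\<close> cannot tell the two apart.\<close>
    also have "\<dots> = (\<integral>\<^sup>+x. indicator B x \<partial>lborel)"
      by (intro nn_integral_cong)
        (simp add: linear_add[OF lin] G indicator_def B_def orthogonal_transformation_norm[OF F])
    finally show "(\<integral>\<^sup>+x. indicator B (y - F x) * indicator A y \<partial>(lborel :: 'a measure))
        = emeasure lborel B * indicator A y"
      by (simp add: nn_integral_multc)
  qed
  also have "\<dots> = emeasure lborel B * emeasure lborel A"
    by (simp add: nn_integral_cmult)
  finally have "emeasure lborel B * emeasure (distr lborel borel F) A = emeasure lborel B * emeasure lborel A"
    using L eq by simp
  \<comment> \<open>The common factor may be cancelled in \<open>ennreal\<close> only because the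
    ball has positive and finite volume.\<close>
  moreover have "emeasure lborel B \<noteq> 0" "emeasure lborel B \<noteq> \<infinity>"
    using less_imp_neq[OF unit_ball_vol_pos, of "real DIM('a)"] by (auto simp: B_def emeasure_ball)
  ultimately show "emeasure (distr lborel borel F) A = emeasure lborel A"
    by (simp add: ennreal_mult_cancel_left)
qed

section \<open>Rotation invariance and product form of the Gaussian law\<close>

lemma std_gauss_space[simp]: "space std_gauss = UNIV"
  and std_gauss_sets[simp, measurable_cong]: "sets std_gauss = sets borel"
  by (simp_all add: std_gauss_def)

lemma emeasure_std_gauss:
  fixes A :: "'a::euclidean_space set"
  assumes "A \<in> sets borel"
  shows "emeasure std_gauss A = (\<integral>\<^sup>+x. ennreal ((2 * pi) powr (- real DIM('a) / 2) * exp (- (norm x)\<^sup>2 / 2))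
    * indicator A x \<partial>lborel)"
  unfolding std_gauss_def using assms by (intro emeasure_density) auto

text \<open>The density depends on the norm alone, which \<open>F\<close> preserves, and Lebesgue
  measure is invariant under \<open>F\<close>.\<close>

lemma distr_std_gauss_orthogonal:
  fixes F :: "'a::euclidean_space \<Rightarrow> 'a"
  assumes F: "orthogonal_transformation F"
  shows "distr std_gauss borel F = std_gauss"
proof (rule measure_eqI)
  show "sets (distr std_gauss borel F) = sets (std_gauss :: 'a measure)" by simp
  fix A assume "A \<in> sets (distr std_gauss borel F)"
  then have A[measurable]: "A \<in> sets borel" by simp
  note orthogonal_transformation_borel_measurable[OF F, measurable]
  let ?d = "\<lambda>x::'a. ennreal ((2 * pi) powr (- real DIM('a) / 2) * exp (- (norm x)\<^sup>2 / 2))"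
  have "emeasure std_gauss A = (\<integral>\<^sup>+x. ?d x * indicator A x \<partial>distr lborel borel F)"
    by (simp add: emeasure_std_gauss distr_lborel_orthogonal[OF F])
  also have "\<dots> = (\<integral>\<^sup>+x. ?d (F x) * indicator A (F x) \<partial>lborel)"
    by (rule nn_integral_distr) auto
  also have "\<dots> = (\<integral>\<^sup>+x. ?d x * indicator (F -` A) x \<partial>lborel)"
    by (intro nn_integral_cong) (simp add: orthogonal_transformation_norm[OF F] indicator_def)
  also have "\<dots> = emeasure std_gauss (F -` A)"
    by (subst emeasure_std_gauss) (auto intro: measurable_sets_borel[OF _ A])
  finally show "emeasure (distr std_gauss borel F) A = emeasure std_gauss A"
    by (simp add: emeasure_distr)
qed

lemma std_normal_measure_space[simp]: "space std_normal_measure = UNIV"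
  and std_normal_measure_sets[simp, measurable_cong]: "sets std_normal_measure = sets borel"
  by (simp_all add: std_normal_measure_def)

lemma prob_space_std_normal_measure: "prob_space std_normal_measure"
  unfolding std_normal_measure_def by (rule prob_space_normal_density) simp

lemma std_gauss_density_eq_prod:
  fixes x :: "'a::euclidean_space"
  shows "(2 * pi) powr (- real DIM('a) / 2) * exp (- (norm x)\<^sup>2 / 2) = (\<Prod>b\<in>Basis. std_normal_density (x \<bullet> b))"
proof -
  have "(\<Prod>b\<in>Basis. std_normal_density (x \<bullet> b)) =
      (1 / sqrt (2 * pi)) ^ DIM('a) * exp (\<Sum>b\<in>Basis. - (x \<bullet> b)\<^sup>2 / 2)"
    unfolding std_normal_density_def prod.distrib by (simp add: exp_sum)
  also have "(\<Sum>b\<in>Basis. - (x \<bullet> b)\<^sup>2 / 2) = - (norm x)\<^sup>2 / 2"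
    by (simp add: sum_negf power2_norm_eq_inner euclidean_inner[of x x] power2_eq_square[of "x \<bullet> _"]
        sum_divide_distrib[symmetric])
  also have "1 / sqrt (2 * pi) = (2 * pi) powr (- (1 / 2))"
    by (simp add: powr_minus_divide powr_half_sqrt)
  also have "((2 * pi) powr (- (1 / 2))) ^ DIM('a) = (2 * pi) powr (- real DIM('a) / 2)"
    by (simp add: powr_power)
  finally show ?thesis by simp
qed

text \<open>Both the density and the indicator of a box factor over the coordinates, and Lebesgue
  measure is a product. Boxes determine a product measure, so this says that the coordinates are
  independent standard normals; full boxes give total mass 1.\<close>

lemma emeasure_std_gauss_box:
  fixes A :: "'a::euclidean_space \<Rightarrow> real set"
  assumes A: "\<And>b. b \<in> Basis \<Longrightarrow> A b \<in> sets borel"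
  shows "emeasure std_gauss {x. \<forall>b\<in>Basis. x \<bullet> b \<in> A b} = (\<Prod>b\<in>Basis. emeasure std_normal_measure (A b))"
proof -
  have m: "{x::'a. \<forall>b\<in>Basis. x \<bullet> b \<in> A b} \<in> sets borel"
  proof -
    have "{x::'a. \<forall>b\<in>Basis. x \<bullet> b \<in> A b} = (\<Inter>b\<in>Basis. (\<lambda>x. x \<bullet> b) -` A b)" by auto
    also have "\<dots> \<in> sets borel"
      using A by (intro sets.finite_INT) (auto intro!: measurable_sets_borel[where M = borel])
    finally show ?thesis .
  qed
  have "emeasure std_gauss {x::'a. \<forall>b\<in>Basis. x \<bullet> b \<in> A b} =
    (\<integral>\<^sup>+x. (\<Prod>b\<in>Basis. ennreal (std_normal_density (x \<bullet> b)) * indicator (A b) (x \<bullet> b)) \<partial>lborel)"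
    unfolding emeasure_std_gauss[OF m] std_gauss_density_eq_prod
  proof (intro nn_integral_cong)
    fix x :: 'a
    have "indicator {x::'a. \<forall>b\<in>Basis. x \<bullet> b \<in> A b} x = (\<Prod>b\<in>Basis. indicator (A b) (x \<bullet> b) :: ennreal)"
      by (cases "\<forall>b\<in>Basis. x \<bullet> b \<in> A b") (auto simp: indicator_def intro!: prod_zero[symmetric])
    then show "ennreal (\<Prod>b\<in>Basis. std_normal_density (x \<bullet> b)) * indicator {x. \<forall>b\<in>Basis. x \<bullet> b \<in> A b} x =
       (\<Prod>b\<in>Basis. ennreal (std_normal_density (x \<bullet> b)) * indicator (A b) (x \<bullet> b))"
      by (simp add: prod.distrib prod_ennreal)
  qed
  also have "\<dots> = (\<Prod>b\<in>Basis. \<integral>\<^sup>+x. ennreal (std_normal_density x) * indicator (A b) x \<partial>lborel)"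
    using A by (intro nn_integral_lborel_prod) auto
  also have "\<dots> = (\<Prod>b\<in>Basis. emeasure std_normal_measure (A b))"
    using A by (intro prod.cong) (auto simp: std_normal_measure_def emeasure_density)
  finally show ?thesis .
qed

lemma prob_space_std_gauss: "prob_space (std_gauss :: 'a::euclidean_space measure)"
proof
  show "emeasure std_gauss (space (std_gauss :: 'a measure)) = 1"
    using emeasure_std_gauss_box[of "\<lambda>_. UNIV"] prob_space.emeasure_space_1[OF prob_space_std_normal_measure]
    by simp
qed

section \<open>Coordinates in an orthonormal system\<close>

text \<open>An orthonormal basis \<open>C\<close> of the orthogonal complement of \<open>S\<close>
  inside \<open>W\<close> is added to \<open>S\<close>; a dimension count shows that the union spans
  \<open>W\<close>. It serves to complete an orthonormal family in the whole space, and to start a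
  basis of the complement of \<open>V\<close> with a prescribed direction.\<close>

lemma orthonormal_extend_to_basis:
  fixes S W :: "'a::euclidean_space set"
  assumes W: "subspace W" and SW: "S \<subseteq> W" and S: "pairwise orthogonal S" "\<And>x. x \<in> S \<Longrightarrow> norm x = 1"
  obtains B where "S \<subseteq> B" "finite B" "pairwise orthogonal B" "\<And>x. x \<in> B \<Longrightarrow> norm x = 1"
    "card B = dim W" "span B = W"
proof -
  define U where "U = {y \<in> W. \<forall>x\<in>span S. orthogonal x y}"
  have U: "U = W \<inter> {y. \<forall>x\<in>span S. orthogonal x y}" by (auto simp: U_def)
  have "subspace U"
    unfolding U by (intro subspace_inter W subspace_orthogonal_to_vectors)
  then obtain C where C: "C \<subseteq> U" "pairwise orthogonal C" "\<And>x. x \<in> C \<Longrightarrow> norm x = 1"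
    "independent C" "card C = dim U"
    using orthonormal_basis_subspace by metis
  have dimU: "dim U + dim (span S) = dim W"
    unfolding U_def by (rule dim_subspace_orthogonal_to_vectors) (use W SW span_minimal in auto)
  have SC: "orthogonal x y" if "x \<in> S" "y \<in> C" for x y
    using that C(1) span_base unfolding U_def by blast
  have orth: "pairwise orthogonal (S \<union> C)"
    using S(1) C(2) SC unfolding pairwise_def by (metis Un_iff orthogonal_commute)
  have nrm: "norm x = 1" if "x \<in> S \<union> C" for x using that S C by auto
  have indep: "independent (S \<union> C)"
    using orth nrm by (intro pairwise_orthogonal_independent) force+
  have indepS: "independent S"
    using indep by (rule independent_mono) auto
  have fin: "finite (S \<union> C)" using indep by (rule independent_imp_finite)
  have "S \<inter> C = {}"
  proof -
    have False if "x \<in> S" "x \<in> C" for x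
      using SC[OF that] S(2)[OF that(1)] by (simp add: orthogonal_def)
    then show ?thesis by auto
  qed
  then have "card (S \<union> C) = card S + card C"
    using fin by (intro card_Un_disjoint) auto
  also have "\<dots> = dim W"
    using dimU C(5) dim_eq_card_independent[OF indepS] by simp
  finally have card: "card (S \<union> C) = dim W" .
  have sub: "S \<union> C \<subseteq> W" using SW C(1) U by auto
  have "span (S \<union> C) = W"
    using card_eq_dim[OF sub] card indep fin sub W by (metis span_subspace)
  with orth nrm fin card show ?thesis by (intro that[of "S \<union> C"]) auto
qed

text \<open>The difference \<open>z\<close> of the two sides lies in \<open>span B\<close> and is
  orthogonal to every element of \<open>B\<close>, hence to itself.\<close>

lemma orthonormal_expansion:
  fixes x :: "'a::euclidean_space"
  assumes "finite B" "pairwise orthogonal B" "\<And>b. b \<in> B \<Longrightarrow> norm b = 1" "x \<in> span B"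
  shows "x = (\<Sum>b\<in>B. (x \<bullet> b) *\<^sub>R b)"
proof -
  define z where "z = x - (\<Sum>b\<in>B. (x \<bullet> b) *\<^sub>R b)"
  have zc: "z \<bullet> c = 0" if c: "c \<in> B" for c
  proof -
    have "(\<Sum>b\<in>B. (x \<bullet> b) *\<^sub>R b) \<bullet> c = (\<Sum>b\<in>B. if b = c then x \<bullet> b else 0)"
      unfolding inner_sum_left
      using assms c by (intro sum.cong) (auto simp: pairwise_def orthogonal_def norm_eq_1)
    also have "\<dots> = x \<bullet> c" using assms(1) c by simp
    finally show ?thesis by (simp add: z_def inner_diff_left)
  qed
  have "z \<in> span B"
    unfolding z_def by (rule span_diff[OF assms(4)]) (intro span_sum span_scale span_base)
  then have "orthogonal z z"
    by (rule orthogonal_to_span) (simp add: orthogonal_def zc)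
  then have "z = 0" by (simp add: orthogonal_self)
  then show ?thesis by (simp add: z_def)
qed

lemma norm_power2_orthonormal:
  fixes x :: "'a::euclidean_space"
  assumes "finite B" "pairwise orthogonal B" "\<And>b. b \<in> B \<Longrightarrow> norm b = 1" "x \<in> span B"
  shows "(norm x)\<^sup>2 = (\<Sum>b\<in>B. (x \<bullet> b)\<^sup>2)"
proof -
  have "(norm x)\<^sup>2 = x \<bullet> (\<Sum>b\<in>B. (x \<bullet> b) *\<^sub>R b)"
    using orthonormal_expansion[OF assms] by (simp add: power2_norm_eq_inner)
  then show ?thesis by (simp add: inner_sum_right power2_eq_square)
qed

text \<open>Realises an orthonormal family indexed by \<open>Basis\<close> as the image of the
  standard basis under an isometry, so that rotation invariance applies to it.\<close>

lemma orthogonal_transformation_basis_change: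
  fixes h :: "'a::euclidean_space \<Rightarrow> 'a"
  assumes "\<And>b c. b \<in> Basis \<Longrightarrow> c \<in> Basis \<Longrightarrow> h b \<bullet> h c = (if b = c then 1 else 0)"
  shows "orthogonal_transformation (\<lambda>x. \<Sum>b\<in>Basis. (x \<bullet> b) *\<^sub>R h b)"
  unfolding orthogonal_transformation_def
proof (intro conjI allI)
  show "linear (\<lambda>x. \<Sum>b\<in>Basis. (x \<bullet> b) *\<^sub>R h b)"
    by (intro linear_compose_sum ballI linearI)
      (auto simp: inner_add_left scaleR_add_left)
  fix v w :: 'a
  have "(\<Sum>b\<in>Basis. (v \<bullet> b) *\<^sub>R h b) \<bullet> (\<Sum>b\<in>Basis. (w \<bullet> b) *\<^sub>R h b) =
      (\<Sum>b\<in>Basis. \<Sum>c\<in>Basis. if b = c then (v \<bullet> b) * (w \<bullet> c) else 0)"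
    unfolding inner_sum_left inner_sum_right using assms
    by (intro sum.cong refl) auto
  also have "\<dots> = v \<bullet> w" by (simp add: euclidean_inner[of v w])
  finally show "(\<Sum>b\<in>Basis. (v \<bullet> b) *\<^sub>R h b) \<bullet> (\<Sum>b\<in>Basis. (w \<bullet> b) *\<^sub>R h b) = v \<bullet> w" .
qed

text \<open>Replacing \<open>e\<close> by \<open>F e\<close> does not change the Gaussian law and
  turns \<open>e \<bullet> F b\<close> into \<open>e \<bullet> b\<close>, so boxes in the rotated
  coordinates have the same probability as boxes in the standard ones.\<close>

lemma distr_std_gauss_orthonormal_basis:
  fixes F :: "'a::euclidean_space \<Rightarrow> 'a"
  assumes F: "orthogonal_transformation F"
  shows "distr std_gauss (PiM Basis (\<lambda>_. std_normal_measure)) (\<lambda>e. \<lambda>b\<in>Basis. e \<bullet> F b)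
    = PiM Basis (\<lambda>_. std_normal_measure)" (is "?D = _")
proof -
  interpret N: prob_space std_normal_measure by (rule prob_space_std_normal_measure)
  interpret product_sigma_finite "\<lambda>_::'a. std_normal_measure" ..
  show ?thesis
  proof (rule PiM_eqI)
    show "finite (Basis :: 'a set)" by simp
    show "sets ?D = sets (PiM Basis (\<lambda>_. std_normal_measure))" by simp
    fix A :: "'a \<Rightarrow> real set" assume A: "\<And>b. b \<in> Basis \<Longrightarrow> A b \<in> sets std_normal_measure"
    note [measurable] = orthogonal_transformation_borel_measurable[OF F]
    have "emeasure ?D (Pi\<^sub>E Basis A) = emeasure std_gauss {e. \<forall>b\<in>Basis. e \<bullet> F b \<in> A b}"
    proof (subst emeasure_distr)
      show "(\<lambda>e. \<lambda>b\<in>Basis. e \<bullet> F b) \<in> std_gauss \<rightarrow>\<^sub>M Pi\<^sub>M Basis (\<lambda>_. std_normal_measure)"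
        by (intro measurable_restrict) simp
      show "Pi\<^sub>E Basis A \<in> sets (Pi\<^sub>M Basis (\<lambda>_. std_normal_measure))"
        using A by (intro sets_PiM_I_finite) auto
    qed (auto intro!: arg_cong[where f = "emeasure std_gauss"])
    also have "\<dots> = emeasure (distr std_gauss borel F) {e. \<forall>b\<in>Basis. e \<bullet> F b \<in> A b}"
      by (simp add: distr_std_gauss_orthogonal[OF F])
    also have "\<dots> = emeasure std_gauss {e. \<forall>b\<in>Basis. e \<bullet> b \<in> A b}"
    proof (subst emeasure_distr)
      have "{e. \<forall>b\<in>Basis. e \<bullet> F b \<in> A b} = (\<Inter>b\<in>Basis. (\<lambda>e. e \<bullet> F b) -` A b)" by auto
      also have "\<dots> \<in> sets borel"
        using A by (intro sets.finite_INT) (auto intro!: measurable_sets_borel[where M = borel])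
      finally show "{e. \<forall>b\<in>Basis. e \<bullet> F b \<in> A b} \<in> sets borel" .
    qed (use F in \<open>auto simp: orthogonal_transformation_def intro!: arg_cong[where f = "emeasure std_gauss"]\<close>)
    also have "\<dots> = (\<Prod>b\<in>Basis. emeasure std_normal_measure (A b))"
      using A by (intro emeasure_std_gauss_box) auto
    finally show "emeasure ?D (Pi\<^sub>E Basis A) = (\<Prod>b\<in>Basis. emeasure std_normal_measure (A b))" .
  qed
qed

text \<open>The family is completed to an orthonormal basis, written as the image of
  \<open>Basis\<close> under an isometry \<open>F\<close>; its coordinates are then a marginal of
  the full product law.\<close>

lemma distr_std_gauss_orthonormal:
  fixes b :: "nat \<Rightarrow> 'a::euclidean_space"
  assumes b: "\<And>i j. i < m \<Longrightarrow> j < m \<Longrightarrow> b i \<bullet> b j = (if i = j then 1 else 0)"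
  shows "distr std_gauss (PiM {..<m} (\<lambda>_. std_normal_measure)) (\<lambda>e. \<lambda>i\<in>{..<m}. e \<bullet> b i)
    = PiM {..<m} (\<lambda>_. std_normal_measure)"
proof -
  have po: "pairwise orthogonal (b ` {..<m})"
    using b by (auto simp: pairwise_def orthogonal_def)
  have nrm: "norm x = 1" if "x \<in> b ` {..<m}" for x
    using b that by (auto simp: norm_eq_1)
  obtain B where B: "b ` {..<m} \<subseteq> B" "finite B" "pairwise orthogonal B" "\<And>x. x \<in> B \<Longrightarrow> norm x = 1"
    "card B = dim (UNIV :: 'a set)"
    using orthonormal_extend_to_basis[OF subspace_UNIV subset_UNIV po nrm] by metis
  then obtain h where h: "bij_betw h (Basis :: 'a set) B"
    using finite_same_card_bij[of "Basis :: 'a set" B] by auto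
  define F where "F = (\<lambda>x::'a. \<Sum>b\<in>Basis. (x \<bullet> b) *\<^sub>R h b)"
  have F: "orthogonal_transformation F"
    unfolding F_def
  proof (rule orthogonal_transformation_basis_change)
    fix c d :: 'a assume cd: "c \<in> Basis" "d \<in> Basis"
    then have "h c \<in> B" "h d \<in> B" "h c = h d \<longleftrightarrow> c = d"
      using h by (auto simp: bij_betw_def inj_on_def)
    then show "h c \<bullet> h d = (if c = d then 1 else 0)"
      using B(3,4) by (auto simp: pairwise_def orthogonal_def norm_eq_1)
  qed
  have Fh: "F c = h c" if "c \<in> Basis" for c
  proof -
    have "F c = (\<Sum>b\<in>Basis. if b = c then h b else 0)"
      unfolding F_def using that by (intro sum.cong) (auto simp: inner_Basis)
    then show ?thesis using that by simp
  qed
  \<comment> \<open>Locates \<open>b i\<close> in the completed basis. Since \<open>k\<close> is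
    injective, reading off the coordinates \<open>k i\<close> of a product law gives a product law
    again.\<close>
  define k where "k = (\<lambda>i. inv_into Basis h (b i))"
  have bB: "b i \<in> h ` Basis" if "i < m" for i
    using B(1) h that by (auto simp: bij_betw_def)
  have k: "k i \<in> Basis" "F (k i) = b i" if "i < m" for i
    using bB[OF that] Fh unfolding k_def by (auto simp: inv_into_into f_inv_into_f)
  have inj: "inj_on k {..<m}"
  proof (rule inj_onI)
    fix i j assume "i \<in> {..<m}" "j \<in> {..<m}" "k i = k j"
    then have "b i = b j" using k(2) by (metis lessThan_iff)
    then show "i = j" using b[of i j] b[of j j] \<open>i \<in> _\<close> \<open>j \<in> _\<close> by (auto split: if_splits)
  qed
  let ?N = "\<lambda>_. std_normal_measure"
  have mF: "(\<lambda>e. \<lambda>b\<in>Basis. e \<bullet> F b) \<in> std_gauss \<rightarrow>\<^sub>M Pi\<^sub>M Basis ?N"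
    by (intro measurable_restrict) simp
  have "PiM {..<m} ?N = distr (PiM Basis ?N) (PiM {..<m} ?N) (\<lambda>\<omega>. \<lambda>i\<in>{..<m}. \<omega> (k i))"
    using inj k(1) by (intro distr_PiM_reindex[symmetric] prob_space_std_normal_measure) auto
  also have "\<dots> = distr (distr std_gauss (PiM Basis ?N) (\<lambda>e. \<lambda>b\<in>Basis. e \<bullet> F b))
      (PiM {..<m} ?N) (\<lambda>\<omega>. \<lambda>i\<in>{..<m}. \<omega> (k i))"
    by (simp add: distr_std_gauss_orthonormal_basis[OF F])
  also have "\<dots> = distr std_gauss (PiM {..<m} ?N) (\<lambda>e. \<lambda>i\<in>{..<m}. e \<bullet> b i)"
  proof (subst distr_distr[OF _ mF])
    show "(\<lambda>\<omega>. \<lambda>i\<in>{..<m}. \<omega> (k i)) \<in> Pi\<^sub>M Basis ?N \<rightarrow>\<^sub>M Pi\<^sub>M {..<m} ?N"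
      using k(1) by (intro measurable_restrict measurable_component_singleton) auto
  qed (auto intro!: distr_cong simp: k restrict_def fun_eq_iff)
  finally show ?thesis by simp
qed

text \<open>The case of a one-element orthonormal family; a product over a single index is
  identified with its factor by testing on one-dimensional boxes.\<close>

lemma distr_std_gauss_inner_unit:
  fixes t :: "'a::euclidean_space"
  assumes "norm t = 1"
  shows "distr std_gauss borel (\<lambda>e. e \<bullet> t) = std_normal_measure"
proof (rule measure_eqI)
  interpret N: prob_space std_normal_measure by (rule prob_space_std_normal_measure)
  interpret product_sigma_finite "\<lambda>_::nat. std_normal_measure" ..
  fix A assume "A \<in> sets (distr std_gauss borel (\<lambda>e. e \<bullet> t))"
  then have A[measurable]: "A \<in> sets borel" by simp
  let ?P = "PiM {..<1::nat} (\<lambda>_. std_normal_measure)"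
  have "emeasure std_normal_measure A = emeasure ?P (Pi\<^sub>E {..<1::nat} (\<lambda>_. A))"
    by (subst emeasure_PiM) auto
  also have "\<dots> = emeasure (distr std_gauss ?P (\<lambda>e. \<lambda>i\<in>{..<1::nat}. e \<bullet> t)) (Pi\<^sub>E {..<1::nat} (\<lambda>_. A))"
    using assms by (subst distr_std_gauss_orthonormal) (auto simp: norm_eq_1)
  also have "\<dots> = emeasure std_gauss ((\<lambda>e. \<lambda>i\<in>{..<1::nat}. e \<bullet> t) -` (Pi\<^sub>E {..<1::nat} (\<lambda>_. A)) \<inter> space std_gauss)"
    by (intro emeasure_distr measurable_restrict sets_PiM_I_finite) simp_all
  also have "(\<lambda>e. \<lambda>i\<in>{..<1::nat}. e \<bullet> t) -` (Pi\<^sub>E {..<1::nat} (\<lambda>_. A)) \<inter> space std_gauss = {e. e \<bullet> t \<in> A}"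
    by (simp add: vimage_def Pi_iff Ball_def)
  also have "{e. e \<bullet> t \<in> A} = (\<lambda>e. e \<bullet> t) -` A \<inter> space std_gauss"
    by (simp add: vimage_def)
  also have "emeasure std_gauss \<dots> = emeasure (distr std_gauss borel (\<lambda>e. e \<bullet> t)) A"
    by (rule emeasure_distr[symmetric]) simp_all
  finally show "emeasure (distr std_gauss borel (\<lambda>e. e \<bullet> t)) A = emeasure std_normal_measure A" ..
qed simp

text \<open>Pulls the product law that defines \<open>nc_chi2\<close> back to the Gaussian vector,
  along any orthonormal family of \<open>m\<close> vectors; the whole noncentrality sits on
  \<open>b 0\<close>.\<close>

lemma nc_chi2_eq_distr_std_gauss:
  fixes b :: "nat \<Rightarrow> 'a::euclidean_space"
  assumes b: "\<And>i j. i < m \<Longrightarrow> j < m \<Longrightarrow> b i \<bullet> b j = (if i = j then 1 else 0)"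
  shows "nc_chi2 m a2 = distr std_gauss borel (\<lambda>e. \<Sum>i<m. (e \<bullet> b i + (if i = 0 then sqrt a2 else 0))\<^sup>2)"
proof -
  have m: "(\<lambda>e. \<lambda>i\<in>{..<m}. e \<bullet> b i) \<in> std_gauss \<rightarrow>\<^sub>M Pi\<^sub>M {..<m} (\<lambda>_. std_normal_measure)"
    by (intro measurable_restrict) simp
  show ?thesis
    unfolding nc_chi2_def
  proof (subst distr_std_gauss_orthonormal[OF b, symmetric], assumption, assumption, subst distr_distr[OF _ m])
    show "(\<lambda>z. \<Sum>i<m. (z i + (if i = 0 then sqrt a2 else 0))\<^sup>2) \<in>
        borel_measurable (Pi\<^sub>M {..<m} (\<lambda>_. std_normal_measure))"
      by measurable
  qed (auto intro!: distr_cong sum.cong)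
qed

section \<open>Quantiles and the standard normal law\<close>

text \<open>The infimum is attained: the bound holds at every point to the right of it, and the
  distribution function is right continuous.\<close>

lemma measure_le_upper_quantile:
  fixes M :: "real measure"
  assumes M: "prob_space M" "sets M = sets borel" and u: "0 < u" "u < 1"
  shows "1 - u \<le> measure M {..upper_quantile M u}"
proof -
  interpret prob_space M by (rule M)
  interpret finite_borel_measure M by standard (rule M)
  let ?S = "{x. 1 - u \<le> cdf M x}" and ?z = "upper_quantile M u"
  have z: "?z = Inf ?S" by (simp add: upper_quantile_def cdf_def)
  \<comment> \<open>\<open>0 < u\<close> makes the set nonempty, and further down
    \<open>u < 1\<close> makes it bounded below; \<open>Inf\<close> on the reals needs both.\<close>
  have "eventually (\<lambda>x. 1 - u < cdf M x) at_top"
    using cdf_lim_at_top u by (intro order_tendstoD) (auto simp: prob_space)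
  then have ne: "?S \<noteq> {}"
    by (auto simp: eventually_at_top_linorder intro: less_imp_le)
  have "eventually (\<lambda>x. cdf M x < 1 - u) at_bot"
    using cdf_lim_at_bot u by (intro order_tendstoD) auto
  then obtain x0 where x0: "cdf M x0 < 1 - u" by (auto simp: eventually_at_bot_linorder)
  have bdd: "bdd_below ?S"
  proof (rule bdd_belowI[of _ x0])
    fix x assume "x \<in> ?S"
    then show "x0 \<le> x" using x0 cdf_nondecreasing[of x x0] by (cases "x0 \<le> x") auto
  qed
  have above: "1 - u \<le> cdf M y" if y: "?z < y" for y
  proof -
    obtain x where "x \<in> ?S" "x < y" using cInf_lessD[OF ne, of y] y unfolding z by blast
    then show ?thesis using cdf_nondecreasing[of x y] by auto
  qed
  have "(cdf M \<longlongrightarrow> cdf M ?z) (at_right ?z)"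
    using cdf_is_right_cont[of ?z] by (simp add: continuous_within)
  moreover have "eventually (\<lambda>y. 1 - u \<le> cdf M y) (at_right ?z)"
    using above by (auto simp: eventually_at_right_field intro: exI[of _ "?z + 1"])
  ultimately have "1 - u \<le> cdf M ?z"
    by (intro tendsto_lowerbound) auto
  then show ?thesis by (simp add: cdf_def)
qed

section \<open>Null sets and symmetry of the Gaussian law\<close>

lemma measure_std_gauss_inner_unit:
  fixes t :: "'a::euclidean_space"
  assumes "norm t = 1" and A[measurable]: "A \<in> sets borel"
  shows "measure std_gauss {e. e \<bullet> t \<in> A} = measure std_normal_measure A"
proof -
  have "measure std_normal_measure A = measure (distr std_gauss borel (\<lambda>e. e \<bullet> t)) A"
    by (simp add: distr_std_gauss_inner_unit[OF assms(1)])
  also have "\<dots> = measure std_gauss ((\<lambda>e. e \<bullet> t) -` A \<inter> space std_gauss)"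
    by (rule measure_distr) simp_all
  finally show ?thesis by (simp add: vimage_def)
qed

text \<open>The Gaussian law has a Lebesgue density. This allows discarding the vectors at which the
  denominator of the statistic vanishes.\<close>

lemma null_sets_std_gauss_negligible:
  assumes "negligible N" "N \<in> sets borel"
  shows "N \<in> null_sets std_gauss"
proof -
  have "N \<in> null_sets lborel"
    using assms by (simp add: negligible_iff_null_sets null_sets_completion_iff)
  then have "AE x in lborel. x \<notin> N" by (rule AE_not_in)
  then have "emeasure std_gauss N = 0"
    unfolding emeasure_std_gauss[OF assms(2)] using assms(2)
    by (subst nn_integral_0_iff_AE) (auto elim: AE_mp)
  then show ?thesis using assms(2) by (simp add: null_sets_def)
qed

lemma measure_std_normal_singleton: "measure std_normal_measure {z} = 0"
proof -
  have "emeasure std_normal_measure {z} = (\<integral>\<^sup>+x. ennreal (std_normal_density x) * indicator {z} x \<partial>lborel)"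
    unfolding std_normal_measure_def by (rule emeasure_density) auto
  also have "\<dots> = 0"
    by (subst nn_integral_0_iff_AE) (auto intro: AE_mp[OF AE_lborel_singleton[of z]])
  finally show ?thesis by (simp add: measure_def)
qed

text \<open>The real line is taken as a one-dimensional Euclidean space: its unit vectors
  \<open>1\<close> and \<open>-1\<close> yield the same law, which is the symmetry. The endpoint has
  mass zero.\<close>

lemma measure_std_normal_greaterThan_uminus:
  "measure std_normal_measure {- z<..} = measure std_normal_measure {..z}"
proof -
  interpret prob_space std_normal_measure by (rule prob_space_std_normal_measure)
  have "measure std_normal_measure {- z<..} = measure std_gauss {e::real. e \<bullet> 1 \<in> {- z<..}}"
    by (rule measure_std_gauss_inner_unit[symmetric]) auto
  also have "{e::real. e \<bullet> 1 \<in> {- z<..}} = {e. e \<bullet> (-1) \<in> {..<z}}" by auto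
  also have "measure std_gauss \<dots> = measure std_normal_measure {..<z}"
    by (rule measure_std_gauss_inner_unit) auto
  also have "\<dots> = measure std_normal_measure ({..<z} \<union> {z})"
    by (subst finite_measure_Union) (auto simp: measure_std_normal_singleton)
  also have "{..<z} \<union> {z} = {..z}" by auto
  finally show ?thesis .
qed

lemma measure_std_normal_positive: "measure std_normal_measure {0<..} = 1 / 2"
proof -
  interpret prob_space std_normal_measure by (rule prob_space_std_normal_measure)
  have "1 = measure std_normal_measure ({..0} \<union> {0<..})"
  proof -
    have "{..0} \<union> {0<..} = (UNIV :: real set)" by auto
    then show ?thesis using prob_space by simp
  qed
  also have "\<dots> = measure std_normal_measure {..0} + measure std_normal_measure {0<..}"
    by (rule finite_measure_Union) auto
  finally show ?thesis
    using measure_std_normal_greaterThan_uminus[of 0] by simp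
qed

section \<open>Orthogonal projections\<close>

text \<open>Two candidates differ by a vector of \<open>V\<close> that is orthogonal to
  \<open>V\<close>, hence to itself; this uniqueness makes the \<open>THE\<close> in
  \<open>orth_proj\<close> usable.\<close>

lemma orth_proj_eqI:
  fixes V :: "'a::euclidean_space set"
  assumes V: "subspace V" and y: "y \<in> V" "\<And>v. v \<in> V \<Longrightarrow> (x - y) \<bullet> v = 0"
  shows "orth_proj V x = y"
  unfolding orth_proj_def
proof (rule the_equality)
  show "y \<in> V \<and> (\<forall>v\<in>V. (x - y) \<bullet> v = 0)" using y by auto
  fix z assume z: "z \<in> V \<and> (\<forall>v\<in>V. (x - z) \<bullet> v = 0)"
  then have d: "z - y \<in> V" using V y subspace_diff by blast
  have "(z - y) \<bullet> (z - y) = (x - y) \<bullet> (z - y) - (x - z) \<bullet> (z - y)"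
    by (simp add: inner_diff_left)
  also have "\<dots> = 0" using z y(2)[OF d] d by simp
  finally show "z = y" by simp
qed

lemma orth_proj_props:
  fixes V :: "'a::euclidean_space set"
  assumes V: "subspace V"
  shows orth_proj_in: "orth_proj V x \<in> V"
    and orth_proj_residual: "v \<in> V \<Longrightarrow> (x - orth_proj V x) \<bullet> v = 0"
proof -
  obtain y z where yz: "y \<in> span V" "\<And>w. w \<in> span V \<Longrightarrow> orthogonal z w" "x = y + z"
    using orthogonal_subspace_decomp_exists[of V x] by metis
  have *: "y \<in> V" "\<And>v. v \<in> V \<Longrightarrow> (x - y) \<bullet> v = 0"
    using yz span_eq_iff[THEN iffD2, OF V] by (auto simp: orthogonal_def)
  then have "orth_proj V x = y" by (intro orth_proj_eqI V)
  with * show "orth_proj V x \<in> V" "v \<in> V \<Longrightarrow> (x - orth_proj V x) \<bullet> v = 0" by auto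
qed

text \<open>Orthogonal projection onto the orthogonal complement of \<open>V\<close>; its norm is
  the denominator in \<open>T_stat\<close>.\<close>

definition perp_proj :: "'a::euclidean_space set \<Rightarrow> 'a \<Rightarrow> 'a" where
  "perp_proj V x = x - orth_proj V x"

context
  fixes V :: "'a::euclidean_space set"
  assumes V: "subspace V"
begin

lemma perp_proj_inner: "v \<in> V \<Longrightarrow> perp_proj V x \<bullet> v = 0"
  unfolding perp_proj_def by (rule orth_proj_residual[OF V])

lemma linear_perp_proj: "linear (perp_proj V)"
proof -
  have add: "orth_proj V (x + y) = orth_proj V x + orth_proj V y" for x y
  proof (rule orth_proj_eqI[OF V])
    show "orth_proj V x + orth_proj V y \<in> V" by (intro subspace_add V orth_proj_in)
    show "(x + y - (orth_proj V x + orth_proj V y)) \<bullet> v = 0" if "v \<in> V" for v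
      using orth_proj_residual[OF V that, of x] orth_proj_residual[OF V that, of y]
      by (simp add: inner_diff_left inner_add_left)
  qed
  have scale: "orth_proj V (c *\<^sub>R x) = c *\<^sub>R orth_proj V x" for c x
  proof (rule orth_proj_eqI[OF V])
    show "c *\<^sub>R orth_proj V x \<in> V" by (intro subspace_scale V orth_proj_in)
    show "(c *\<^sub>R x - c *\<^sub>R orth_proj V x) \<bullet> v = 0" if "v \<in> V" for v
      using orth_proj_residual[OF V that, of x] by (simp add: inner_diff_left)
  qed
  show ?thesis
    by (rule linearI) (simp_all add: perp_proj_def add scale scaleR_diff_right)
qed

lemma perp_proj_measurable [measurable]: "perp_proj V \<in> borel_measurable borel"
  using linear_perp_proj
  by (intro borel_measurable_continuous_onI linear_continuous_on) (simp add: linear_conv_bounded_linear)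

lemma perp_proj_fixes:
  assumes "\<And>v. v \<in> V \<Longrightarrow> g \<bullet> v = 0"
  shows "perp_proj V g = g"
  using orth_proj_eqI[OF V, of 0 g] assms V by (simp add: perp_proj_def subspace_0)

lemma perp_proj_idem: "perp_proj V (perp_proj V x) = perp_proj V x"
  by (intro perp_proj_fixes perp_proj_inner)

lemma perp_proj_eq_0_iff: "perp_proj V x = 0 \<longleftrightarrow> x \<in> V"
proof
  show "perp_proj V x = 0 \<Longrightarrow> x \<in> V"
    using orth_proj_in[OF V, of x] by (simp add: perp_proj_def)
  show "x \<in> V \<Longrightarrow> perp_proj V x = 0"
    using orth_proj_eqI[OF V, of x x] by (simp add: perp_proj_def)
qed

lemma norm_power2_perp_proj: "(norm x)\<^sup>2 = (norm (orth_proj V x))\<^sup>2 + (norm (perp_proj V x))\<^sup>2"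
proof -
  have "perp_proj V x \<bullet> orth_proj V x = 0" by (intro perp_proj_inner orth_proj_in V)
  then have "(norm (orth_proj V x + perp_proj V x))\<^sup>2 = (norm (orth_proj V x))\<^sup>2 + (norm (perp_proj V x))\<^sup>2"
    by (intro norm_add_Pythagorean) (simp add: orthogonal_def inner_commute)
  then show ?thesis by (simp add: perp_proj_def)
qed

text \<open>This is the reflection that fixes \<open>V\<close> and negates its orthogonal
  complement, so norms are kept by Pythagoras. It is the linear part of the affine isometry used for
  the level.\<close>

lemma orthogonal_transformation_reflect_perp:
  "orthogonal_transformation (\<lambda>x. x - 2 *\<^sub>R perp_proj V x)"
  unfolding orthogonal_transformation
proof (intro conjI allI)
  show "linear (\<lambda>x. x - 2 *\<^sub>R perp_proj V x)"
    by (intro linear_compose_sub linear_ident linear_compose_scale_right linear_perp_proj)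
  fix x
  have *: "perp_proj V x \<bullet> orth_proj V x = 0" by (intro perp_proj_inner orth_proj_in V)
  have "(norm (x - 2 *\<^sub>R perp_proj V x))\<^sup>2 = (norm (orth_proj V x - perp_proj V x))\<^sup>2"
    by (simp add: perp_proj_def algebra_simps scaleR_2)
  also have "\<dots> = (norm x)\<^sup>2"
    unfolding norm_power2_perp_proj[of x] using *
    by (simp add: power2_norm_eq_inner inner_diff_left inner_diff_right inner_commute)
  finally show "norm (x - 2 *\<^sub>R perp_proj V x) = norm x" by simp
qed

text \<open>In an orthonormal basis of the complement of \<open>V\<close> whose first vector points
  along \<open>g\<close>, the coordinates of \<open>perp_proj V e + g\<close> are those of
  \<open>e\<close>, with \<open>norm g\<close> added to the first one only.\<close>

lemma nc_chi2_eq_distr_perp_proj: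
  assumes d: "dim V < DIM('a)" and g: "\<And>v. v \<in> V \<Longrightarrow> g \<bullet> v = 0"
  shows "nc_chi2 (DIM('a) - dim V) ((norm g)\<^sup>2) = distr std_gauss borel (\<lambda>e. (norm (perp_proj V e + g))\<^sup>2)"
proof -
  define W where "W = {y. \<forall>x\<in>V. orthogonal x y}"
  define m where "m = DIM('a) - dim V"
  have sW: "subspace W" unfolding W_def by (rule subspace_orthogonal_to_vectors)
  have "dim W + dim V = DIM('a)"
    using dim_subspace_orthogonal_to_vectors[OF V subspace_UNIV] by (simp add: W_def)
  then have dW: "dim W = m" by (simp add: m_def)
  have m0: "m > 0" using d by (simp add: m_def)
  have inW: "x \<in> W \<longleftrightarrow> (\<forall>v\<in>V. x \<bullet> v = 0)" for x
    by (simp add: W_def orthogonal_def inner_commute)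
  have gW: "g \<in> W" using g by (simp add: inW)
  \<comment> \<open>The direction of \<open>g\<close>; if \<open>g = 0\<close>, any unit vector of
    \<open>W\<close> will do, and one exists because \<open>dim V < DIM('a)\<close>.\<close>
  obtain w where w: "w \<in> W" "norm w = 1" "g = norm g *\<^sub>R w"
  proof (cases "g = 0")
    case True
    obtain x where x: "x \<in> W" "x \<noteq> 0" using dW m0 dim_eq_0[of W] by auto
    show ?thesis
      by (rule that[of "x /\<^sub>R norm x"]) (use x sW True in \<open>auto intro: subspace_scale\<close>)
  next
    case False
    show ?thesis
      by (rule that[of "g /\<^sub>R norm g"]) (use False gW sW in \<open>auto intro: subspace_scale\<close>)
  qed
  obtain B where B: "{w} \<subseteq> B" "finite B" "pairwise orthogonal B" "\<And>x. x \<in> B \<Longrightarrow> norm x = 1"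
    "card B = dim W" "span B = W"
    using orthonormal_extend_to_basis[OF sW, of "{w}"] w by auto
  \<comment> \<open>Index 0 is reserved for \<open>w\<close>, since \<open>nc_chi2\<close> puts its
    shift there; the other \<open>m - 1\<close> basis vectors get the indices from 1 on.\<close>
  have "card {1..<m} = card (B - {w})" using B dW by simp
  then obtain h where h: "bij_betw h {1..<m} (B - {w})"
    using finite_same_card_bij[of "{1..<m}" "B - {w}"] B(2) by auto
  define b where "b i = (if i = 0 then w else h i)" for i
  have hB: "h i \<in> B - {w}" if "0 < i" "i < m" for i
    using bij_betwE[OF h] that by auto
  have bB: "b i \<in> B" if "i < m" for i
    using that B(1) hB by (auto simp: b_def)
  have inj: "inj_on b {..<m}"
  proof (rule inj_onI)
    fix i j assume ij: "i \<in> {..<m}" "j \<in> {..<m}" "b i = b j"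
    show "i = j"
    proof (cases "i = 0 \<or> j = 0")
      case True
      then show ?thesis using ij hB[of i] hB[of j] by (auto simp: b_def split: if_splits)
    next
      case False
      then show ?thesis
        using ij bij_betw_imp_inj_on[OF h] by (auto simp: b_def inj_on_def)
    qed
  qed
  have im: "b ` {..<m} = B"
    using inj bB dW B(2,5) by (intro card_subset_eq) (auto simp: card_image)
  have ortho: "b i \<bullet> b j = (if i = j then 1 else 0)" if "i < m" "j < m" for i j
  proof (cases "i = j")
    case True
    then show ?thesis using B(4)[OF bB[OF that(1)]] by (simp add: norm_eq_1)
  next
    case False
    then have "b i \<noteq> b j" using inj that by (auto simp: inj_on_def)
    then show ?thesis using B(3) bB that False by (auto simp: pairwise_def orthogonal_def)
  qed
  have "(norm (perp_proj V e + g))\<^sup>2 = (\<Sum>i<m. (e \<bullet> b i + (if i = 0 then sqrt ((norm g)\<^sup>2) else 0))\<^sup>2)" for e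
  proof -
    have "perp_proj V e + g \<in> W"
      using perp_proj_inner g by (auto simp: inW inner_add_left)
    then have "(norm (perp_proj V e + g))\<^sup>2 = (\<Sum>c\<in>B. ((perp_proj V e + g) \<bullet> c)\<^sup>2)"
      using B by (intro norm_power2_orthonormal) auto
    also have "\<dots> = (\<Sum>i<m. ((perp_proj V e + g) \<bullet> b i)\<^sup>2)"
      using sum.reindex[OF inj, of "\<lambda>c. ((perp_proj V e + g) \<bullet> c)\<^sup>2"] by (simp add: im)
    also have "\<dots> = (\<Sum>i<m. (e \<bullet> b i + (if i = 0 then sqrt ((norm g)\<^sup>2) else 0))\<^sup>2)"
    proof (intro sum.cong refl)
      fix i assume i: "i \<in> {..<m}"
      have "b i \<in> W" using bB i B(6) span_base by auto
      then have "orth_proj V e \<bullet> b i = 0"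
        using orth_proj_in[OF V, of e] by (metis inW inner_commute)
      moreover have "g \<bullet> b i = (if i = 0 then norm g else 0)"
      proof -
        have "g \<bullet> b i = norm g * (b 0 \<bullet> b i)"
          by (subst w(3)) (simp add: b_def)
        then show ?thesis using ortho[of 0 i] i m0 by auto
      qed
      ultimately show "((perp_proj V e + g) \<bullet> b i)\<^sup>2 = (e \<bullet> b i + (if i = 0 then sqrt ((norm g)\<^sup>2) else 0))\<^sup>2"
        by (simp add: perp_proj_def inner_add_left inner_diff_left)
    qed
    finally show ?thesis .
  qed
  then show ?thesis
    using nc_chi2_eq_distr_std_gauss[of m b "(norm g)\<^sup>2"] ortho by (simp add: m_def)
qed

end

section \<open>Level and power\<close>

text \<open>The affine map \<open>\<lambda>y. F y + c\<close> preserves Lebesgue measure, and on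
  \<open>S\<close> it does not increase the norm, so the Gaussian density at the image is at least
  the density at the source.\<close>

lemma std_gauss_le_of_contracting_isometry:
  fixes F :: "'a::euclidean_space \<Rightarrow> 'a"
  assumes F: "orthogonal_transformation F"
    and S[measurable]: "S \<in> sets borel" "S' \<in> sets borel"
    and SS': "\<And>y. y \<in> S \<Longrightarrow> F y + c \<in> S'" "\<And>y. y \<in> S \<Longrightarrow> norm (F y + c) \<le> norm y"
  shows "measure std_gauss S \<le> measure std_gauss S'"
proof -
  interpret prob_space "std_gauss :: 'a measure" by (rule prob_space_std_gauss)
  note [measurable] = orthogonal_transformation_borel_measurable[OF F]
  let ?d = "\<lambda>x::'a. ennreal ((2 * pi) powr (- real DIM('a) / 2) * exp (- (norm x)\<^sup>2 / 2))"
  have "emeasure std_gauss S = (\<integral>\<^sup>+x. ?d x * indicator S x \<partial>lborel)"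
    by (rule emeasure_std_gauss) simp
  also have "\<dots> \<le> (\<integral>\<^sup>+x. ?d (F x + c) * indicator S' (F x + c) \<partial>lborel)"
  proof (rule nn_integral_mono)
    fix x :: 'a
    show "?d x * indicator S x \<le> ?d (F x + c) * indicator S' (F x + c)"
    proof (cases "x \<in> S")
      case True
      then have "(norm (F x + c))\<^sup>2 \<le> (norm x)\<^sup>2" by (intro power_mono SS') auto
      then show ?thesis using True SS'(1)[OF True]
        by (auto intro!: ennreal_leI mult_left_mono)
    qed simp
  qed
  also have "\<dots> = (\<integral>\<^sup>+x. ?d (x + c) * indicator S' (x + c) \<partial>distr lborel borel F)"
    by (rule nn_integral_distr[symmetric]) simp_all
  also have "\<dots> = (\<integral>\<^sup>+x. ?d (x + c) * indicator S' (x + c) \<partial>lborel)"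
    by (simp only: distr_lborel_orthogonal[OF F])
  also have "\<dots> = (\<integral>\<^sup>+x. ?d x * indicator S' x \<partial>lborel)"
    by (rule nn_integral_lborel_translate[where f = "\<lambda>x. ?d x * indicator S' x"]) simp
  also have "\<dots> = emeasure std_gauss S'"
    by (rule emeasure_std_gauss[symmetric]) simp
  finally show ?thesis by (simp add: emeasure_eq_measure)
qed

lemma measure_gauss_law:
  fixes A :: "'a::euclidean_space set"
  assumes A[measurable]: "A \<in> sets borel"
  shows "measure (gauss_law f \<sigma>) A = measure std_gauss {e. f + \<sigma> *\<^sub>R e \<in> A}"
proof -
  have "measure (gauss_law f \<sigma>) A = measure std_gauss ((\<lambda>e. f + \<sigma> *\<^sub>R e) -` A \<inter> space std_gauss)"
    unfolding gauss_law_def by (rule measure_distr) simp_all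
  then show ?thesis by (simp add: vimage_def)
qed

lemma std_gauss_null_diff:
  fixes A :: "'a::euclidean_space set"
  assumes "subspace V" "dim V < DIM('a)" and A: "A \<in> sets borel"
  shows "measure std_gauss (A - V) = measure std_gauss A"
proof -
  have "V \<in> null_sets std_gauss"
    using assms by (intro null_sets_std_gauss_negligible negligible_lowdim borel_closed closed_subspace)
  then show ?thesis using A by (intro measure_Diff_null_set) auto
qed

section \<open>Rejection region, level and power of the test\<close>

context
  fixes V Tn :: "'a::euclidean_space set" and q :: "'a \<Rightarrow> real"
  assumes V: "subspace V" and dV: "dim V < DIM('a)"
    and Tn: "finite Tn" "Tn \<noteq> {}" "Tn \<subseteq> V"
begin

text \<open>Reduces the events below to finite unions over \<open>Tn\<close>. For
  \<open>y \<in> V\<close> the quotient is 0 by the convention for division, so there the sign of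
  \<open>q t\<close> decides.\<close>

lemma T_stat_pos_iff:
  "T_stat V Tn q y > 0 \<longleftrightarrow>
    (\<exists>t\<in>Tn. q t < sqrt (real (DIM('a) - dim V)) * (y \<bullet> t) / norm (perp_proj V y))"
  unfolding T_stat_def perp_proj_def[symmetric] using Tn(1,2) by (subst Max_gr_iff) auto

lemma T_stat_pos_measurable: "{y. T_stat V Tn q y > 0} \<in> sets borel"
proof -
  note [measurable] = perp_proj_measurable[OF V]
  have "{y. T_stat V Tn q y > 0} =
      (\<Union>t\<in>Tn. {y. q t < sqrt (real (DIM('a) - dim V)) * (y \<bullet> t) / norm (perp_proj V y)})"
    by (auto simp: T_stat_pos_iff)
  also have "\<dots> \<in> sets borel" using Tn(1) by (intro sets.finite_UN) measurable
  finally show ?thesis .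
qed

text \<open>If \<open>q t \<le> 0\<close>, the test would reject on the half-space
  \<open>e \<bullet> t > 0\<close> outside \<open>V\<close>, which has probability 1/2.\<close>

lemma q_pos_of_level_less_half:
  assumes t: "t \<in> Tn" "norm t = 1" and lvl: "measure std_gauss {e. T_stat V Tn q e > 0} < 1 / 2"
  shows "q t > 0"
proof (rule ccontr)
  interpret prob_space "std_gauss :: 'a measure" by (rule prob_space_std_gauss)
  assume "\<not> q t > 0"
  then have q: "q t \<le> 0" by simp
  let ?A = "{e. e \<bullet> t \<in> {0<..}}"
  have A: "?A \<in> sets borel"
    by (auto simp: inner_commute intro: borel_open open_halfspace_gt)
  have "measure std_gauss ?A = 1 / 2"
    by (subst measure_std_gauss_inner_unit[OF t(2)]) (auto simp: measure_std_normal_positive)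
  then have "1 / 2 = measure std_gauss (?A - V)"
    using std_gauss_null_diff[OF V dV A] by simp
  also have "\<dots> \<le> measure std_gauss {e. T_stat V Tn q e > 0}"
  proof (rule finite_measure_mono)
    show "?A - V \<subseteq> {e. T_stat V Tn q e > 0}"
    proof
      fix e assume e: "e \<in> ?A - V"
      then have "0 < sqrt (real (DIM('a) - dim V)) * (e \<bullet> t) / norm (perp_proj V e)"
        using dV by (auto simp: perp_proj_eq_0_iff[OF V] intro!: divide_pos_pos mult_pos_pos)
      then show "e \<in> {e. T_stat V Tn q e > 0}" using q t(1) by (force simp: T_stat_pos_iff)
    qed
  qed (simp add: T_stat_pos_measurable)
  finally show False using lvl by simp
qed

text \<open>For \<open>g = 0\<close> this is the rejection region with the denominator cleared, up to a null set.\<close>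
definition shifted_region :: "'a \<Rightarrow> 'a set" where
  "shifted_region g = {y. \<exists>t\<in>Tn. q t * norm (perp_proj V y + g) < sqrt (real (DIM('a) - dim V)) * (y \<bullet> t)}"

lemma shifted_region_measurable: "shifted_region g \<in> sets borel"
proof -
  note [measurable] = perp_proj_measurable[OF V]
  have "shifted_region g =
      (\<Union>t\<in>Tn. {y. q t * norm (perp_proj V y + g) < sqrt (real (DIM('a) - dim V)) * (y \<bullet> t)})"
    by (auto simp: shifted_region_def)
  also have "\<dots> \<in> sets borel" using Tn(1) by (intro sets.finite_UN) measurable
  finally show ?thesis .
qed

text \<open>The intersection of the two regions counts on both sides, so it suffices to compare the
  set differences, by an affine isometry that maps one into the other.\<close>

lemma measure_shifted_region_le:
  assumes q: "\<And>t. t \<in> Tn \<Longrightarrow> q t > 0" and g: "\<And>v. v \<in> V \<Longrightarrow> g \<bullet> v = 0"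
  shows "measure std_gauss (shifted_region g) \<le> measure std_gauss (shifted_region 0)"
proof -
  interpret prob_space "std_gauss :: 'a measure" by (rule prob_space_std_gauss)
  let ?P = "perp_proj V" and ?A = "shifted_region"
  let ?F = "\<lambda>y. y - 2 *\<^sub>R ?P y"
  have lin: "linear ?P" by (rule linear_perp_proj[OF V])
  note m = shifted_region_measurable
  have "measure std_gauss (?A g - ?A 0) \<le> measure std_gauss (?A 0 - ?A g)"
  \<comment> \<open>The translation by \<open>- g\<close> follows the reflection, so that the
    component orthogonal to \<open>V\<close> goes from \<open>?P y\<close> to
    \<open>- (?P y + g)\<close> and the component in \<open>V\<close> stays.\<close>
  proof (rule std_gauss_le_of_contracting_isometry[where c = "- g"])
    show "orthogonal_transformation ?F" by (rule orthogonal_transformation_reflect_perp[OF V])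
    show "?A g - ?A 0 \<in> sets borel" "?A 0 - ?A g \<in> sets borel" using m by auto
    fix y assume y: "y \<in> ?A g - ?A 0"
    let ?y = "?F y + - g"
    have P: "?P ?y = - (?P y + g)"
      by (simp add: linear_diff[OF lin] linear_add[OF lin] linear_cmul[OF lin] perp_proj_idem[OF V]
          perp_proj_fixes[OF V g] scaleR_2)
    have O: "orth_proj V ?y = orth_proj V y"
    proof -
      have "orth_proj V ?y = ?y - ?P ?y" by (simp add: perp_proj_def)
      also have "\<dots> = orth_proj V y" unfolding P by (simp add: perp_proj_def scaleR_2)
      finally show ?thesis .
    qed
    have yt: "?y \<bullet> t = y \<bullet> t" if "t \<in> Tn" for t
      using that Tn(3) g[of t] perp_proj_inner[OF V, of t y] by (auto simp: inner_diff_left)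
    \<comment> \<open>The map exchanges \<open>norm (?P y)\<close> and
      \<open>norm (?P y + g)\<close> and keeps every \<open>y \<bullet> t\<close>, hence it
      exchanges the conditions for membership in the two regions.\<close>
    have n1: "norm (?P ?y) = norm (?P y + g)" unfolding P by (rule norm_minus_cancel)
    have n2: "norm (?P ?y + g) = norm (?P y)" unfolding P by simp
    show "?y \<in> ?A 0 - ?A g"
      using y yt n1 n2 by (auto simp: shifted_region_def)
    \<comment> \<open>The \<open>t\<close> that puts \<open>y\<close> into \<open>?A g\<close> fails
      for \<open>?A 0\<close>; positivity of \<open>q t\<close> then turns the two inequalities into
      a comparison of norms.\<close>
    obtain t where t: "t \<in> Tn" "q t * norm (?P y + g) < sqrt (real (DIM('a) - dim V)) * (y \<bullet> t)"
      using y by (auto simp: shifted_region_def)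
    moreover have "sqrt (real (DIM('a) - dim V)) * (y \<bullet> t) \<le> q t * norm (?P y)"
      using y t(1) by (auto simp: shifted_region_def not_less)
    ultimately have "q t * norm (?P y + g) < q t * norm (?P y)" by linarith
    then have "norm (?P y + g) < norm (?P y)" using q[OF t(1)] by simp
    then have "(norm ?y)\<^sup>2 \<le> (norm y)\<^sup>2"
      unfolding norm_power2_perp_proj[OF V, of ?y] norm_power2_perp_proj[OF V, of y] O n1
      by (simp add: power_mono)
    then show "norm ?y \<le> norm y" by (rule power2_le_imp_le) simp
  qed
  moreover have "measure std_gauss (?A g) = measure std_gauss (?A g \<inter> ?A 0) + measure std_gauss (?A g - ?A 0)"
    using m by (subst finite_measure_Union[symmetric]) (auto intro!: arg_cong[where f = "measure std_gauss"])
  moreover have "measure std_gauss (?A 0) = measure std_gauss (?A g \<inter> ?A 0) + measure std_gauss (?A 0 - ?A g)"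
    using m by (subst finite_measure_Union[symmetric]) (auto intro!: arg_cong[where f = "measure std_gauss"])
  ultimately show ?thesis by linarith
qed

text \<open>Rejection under \<open>f\<close> forces the noise into a shifted region, whose
  probability is largest without shift; the unshifted region is the rejection event under pure
  noise, up to a null set.\<close>

lemma T_stat_level_bound:
  assumes q: "\<And>t. t \<in> Tn \<Longrightarrow> q t > 0" and f: "\<And>t. t \<in> Tn \<Longrightarrow> f \<bullet> t \<le> 0" and \<sigma>: "\<sigma> > 0"
  shows "measure (gauss_law f \<sigma>) {y. T_stat V Tn q y > 0} \<le> measure std_gauss {e. T_stat V Tn q e > 0}"
proof -
  interpret prob_space "std_gauss :: 'a measure" by (rule prob_space_std_gauss)
  let ?P = "perp_proj V" and ?s = "sqrt (real (DIM('a) - dim V))"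
  define g where "g = ?P f /\<^sub>R \<sigma>"
  have lin: "linear ?P" by (rule linear_perp_proj[OF V])
  have "measure (gauss_law f \<sigma>) {y. T_stat V Tn q y > 0} =
      measure std_gauss {e. T_stat V Tn q (f + \<sigma> *\<^sub>R e) > 0}"
    by (simp add: measure_gauss_law T_stat_pos_measurable)
  also have "\<dots> \<le> measure std_gauss (shifted_region g)"
  proof (rule finite_measure_mono)
    show "{e. T_stat V Tn q (f + \<sigma> *\<^sub>R e) > 0} \<subseteq> shifted_region g"
    proof
      fix e assume "e \<in> {e. T_stat V Tn q (f + \<sigma> *\<^sub>R e) > 0}"
      then obtain t where t: "t \<in> Tn"
        "q t < ?s * ((f + \<sigma> *\<^sub>R e) \<bullet> t) / norm (?P (f + \<sigma> *\<^sub>R e))"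
        by (auto simp: T_stat_pos_iff)
      \<comment> \<open>With a zero denominator the quotient would be 0, and \<open>q t > 0\<close>
        excludes that.\<close>
      have nz: "norm (?P (f + \<sigma> *\<^sub>R e)) > 0"
        using t q[OF t(1)] by (cases "?P (f + \<sigma> *\<^sub>R e) = 0") auto
      have "?P (f + \<sigma> *\<^sub>R e) = \<sigma> *\<^sub>R (?P e + g)"
        using \<sigma> by (simp add: linear_add[OF lin] linear_cmul[OF lin] g_def scaleR_add_right)
      then have "norm (?P (f + \<sigma> *\<^sub>R e)) = \<sigma> * norm (?P e + g)" using \<sigma> by simp
      then have "\<sigma> * (q t * norm (?P e + g)) < ?s * ((f + \<sigma> *\<^sub>R e) \<bullet> t)"
        using t(2) nz by (simp add: pos_less_divide_eq mult.left_commute)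
      \<comment> \<open>Here the cone condition \<open>f \<bullet> t \<le> 0\<close> removes the
        signal from the numerator.\<close>
      also have "\<dots> \<le> ?s * (\<sigma> * (e \<bullet> t))"
        using f[OF t(1)] by (intro mult_left_mono) (auto simp: inner_add_left)
      also have "\<dots> = \<sigma> * (?s * (e \<bullet> t))" by simp
      finally have "q t * norm (?P e + g) < ?s * (e \<bullet> t)" using \<sigma> by simp
      then show "e \<in> shifted_region g" using t(1) by (auto simp: shifted_region_def)
    qed
  qed (simp add: shifted_region_measurable)
  also have "\<dots> \<le> measure std_gauss (shifted_region 0)"
    by (rule measure_shifted_region_le) (simp_all add: q g_def perp_proj_inner[OF V])
  \<comment> \<open>Off \<open>V\<close> the denominator is nonzero, so one may divide and return to
    the statistic itself.\<close>
  also have "\<dots> = measure std_gauss (shifted_region 0 - V)"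
    by (rule std_gauss_null_diff[OF V dV shifted_region_measurable, symmetric])
  also have "\<dots> \<le> measure std_gauss {e. T_stat V Tn q e > 0}"
  proof (rule finite_measure_mono)
    show "shifted_region 0 - V \<subseteq> {e. T_stat V Tn q e > 0}"
    proof
      fix e assume e: "e \<in> shifted_region 0 - V"
      then have "norm (?P e) > 0" by (simp add: perp_proj_eq_0_iff[OF V])
      then show "e \<in> {e. T_stat V Tn q e > 0}"
        using e by (auto simp: shifted_region_def T_stat_pos_iff pos_less_divide_eq)
    qed
  qed (simp add: T_stat_pos_measurable)
  finally show ?thesis .
qed

text \<open>Numerator and denominator are both homogeneous of degree one, so for
  \<open>f = 0\<close> the rejection probability does not depend on \<sigma>.\<close>

lemma T_stat_scale:
  assumes "\<sigma> > 0"
  shows "T_stat V Tn q (\<sigma> *\<^sub>R e) > 0 \<longleftrightarrow> T_stat V Tn q e > 0"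
  using assms by (simp add: T_stat_pos_iff linear_cmul[OF linear_perp_proj[OF V]])

text \<open>\<open>E1\<close> bounds the denominator by the chi-square quantile and
  \<open>E2\<close> bounds the noise along \<open>t\<close> by the normal quantile. Each fails with
  probability at most \<beta>/2, and when both hold the single direction \<open>t\<close> already
  rejects, outside a null set.\<close>

lemma T_stat_power_bound:
  assumes t: "t \<in> Tn" "norm t = 1" and q: "q t > 0" and \<sigma>: "\<sigma> > 0" and \<beta>: "0 < \<beta>" "\<beta> < 1"
    and ft: "f \<bullet> t \<ge> (q t * (1 / sqrt (real (DIM('a) - dim V)))
        * sqrt (upper_quantile (nc_chi2 (DIM('a) - dim V) ((norm (f - orth_proj V f))\<^sup>2 / \<sigma>\<^sup>2)) (\<beta>/2))
        + upper_quantile std_normal_measure (\<beta>/2)) * \<sigma>"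
  shows "measure (gauss_law f \<sigma>) {y. T_stat V Tn q y > 0} \<ge> 1 - \<beta>"
proof -
  interpret prob_space "std_gauss :: 'a measure" by (rule prob_space_std_gauss)
  let ?P = "perp_proj V" and ?s = "sqrt (real (DIM('a) - dim V))"
  define g where "g = ?P f /\<^sub>R \<sigma>"
  have lin: "linear ?P" by (rule linear_perp_proj[OF V])
  note [measurable] = perp_proj_measurable[OF V]
  have s: "?s > 0" using dV by simp
  define M where "M = nc_chi2 (DIM('a) - dim V) ((norm g)\<^sup>2)"
  have Mg: "nc_chi2 (DIM('a) - dim V) ((norm (f - orth_proj V f))\<^sup>2 / \<sigma>\<^sup>2) = M"
    using \<sigma> by (simp add: M_def g_def perp_proj_def power_mult_distrib divide_inverse power_inverse mult.commute)
  have M: "M = distr std_gauss borel (\<lambda>e. (norm (?P e + g))\<^sup>2)"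
    unfolding M_def by (rule nc_chi2_eq_distr_perp_proj[OF V dV]) (simp add: g_def perp_proj_inner[OF V])
  define x where "x = upper_quantile M (\<beta> / 2)"
  define z where "z = upper_quantile std_normal_measure (\<beta> / 2)"
  define E1 where "E1 = {e. (norm (?P e + g))\<^sup>2 \<le> x}"
  \<comment> \<open>The half-line is open so that the final inequality is strict, as
    \<open>T_stat > 0\<close> requires; by symmetry it has the mass of \<open>{..z}\<close>.\<close>
  define E2 where "E2 = {e. e \<bullet> t \<in> {- z<..}}"
  have E1[measurable]: "E1 \<in> sets borel" unfolding E1_def by measurable
  have E2[measurable]: "E2 \<in> sets borel" unfolding E2_def
    by (auto simp: inner_commute intro: borel_open open_halfspace_gt)
  have "1 - \<beta> / 2 \<le> measure M {..x}"
    unfolding x_def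
    by (rule measure_le_upper_quantile) (use \<beta> in \<open>auto simp: M intro!: prob_space_distr\<close>)
  also have "\<dots> = measure std_gauss ((\<lambda>e. (norm (?P e + g))\<^sup>2) -` {..x} \<inter> space std_gauss)"
    unfolding M by (rule measure_distr) simp_all
  also have "\<dots> = measure std_gauss E1" by (simp add: E1_def vimage_def)
  finally have p1: "1 - \<beta> / 2 \<le> measure std_gauss E1" .
  have "1 - \<beta> / 2 \<le> measure std_normal_measure {..z}"
    unfolding z_def
    by (rule measure_le_upper_quantile) (use \<beta> in \<open>auto intro: prob_space_std_normal_measure\<close>)
  also have "\<dots> = measure std_gauss E2"
    unfolding E2_def measure_std_normal_greaterThan_uminus[symmetric]
    by (rule measure_std_gauss_inner_unit[OF t(2), symmetric]) simp
  finally have p2: "1 - \<beta> / 2 \<le> measure std_gauss E2" .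
  \<comment> \<open>The noise vectors for which the observation falls into \<open>V\<close> and the
    denominator vanishes; they lie in a translate of \<open>V\<close>, a null set.\<close>
  define N where "N = {e. f + \<sigma> *\<^sub>R e \<in> V}"
  have "measure std_gauss (E1 \<union> E2) = measure std_gauss E1 + measure std_gauss E2 - measure std_gauss (E1 \<inter> E2)"
    using measure_Un3[of E1 std_gauss E2] by (simp add: fmeasurable_eq_sets)
  then have "1 - \<beta> \<le> measure std_gauss (E1 \<inter> E2)"
    using p1 p2 prob_le_1[of "E1 \<union> E2"] by simp
  also have "\<dots> = measure std_gauss (E1 \<inter> E2 - N)"
  proof -
    have "negligible N"
    proof (rule negligible_subset)
      show "negligible ((+) (- (f /\<^sub>R \<sigma>)) ` V)"
        by (intro negligible_translation negligible_lowdim dV)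
      show "N \<subseteq> (+) (- (f /\<^sub>R \<sigma>)) ` V"
      proof
        fix e assume e: "e \<in> N"
        have "e = - (f /\<^sub>R \<sigma>) + (1 / \<sigma>) *\<^sub>R (f + \<sigma> *\<^sub>R e)"
          using \<sigma> by (simp add: scaleR_add_right divide_inverse)
        moreover have "(1 / \<sigma>) *\<^sub>R (f + \<sigma> *\<^sub>R e) \<in> V" using e V by (auto simp: N_def intro: subspace_scale)
        ultimately show "e \<in> (+) (- (f /\<^sub>R \<sigma>)) ` V" by blast
      qed
    qed
    moreover have "N \<in> sets borel"
    proof -
      have "N = (\<lambda>e. f + \<sigma> *\<^sub>R e) -` V" by (auto simp: N_def)
      also have "\<dots> \<in> sets borel"
        using V by (intro measurable_sets_borel[where M = borel]) (auto intro: borel_closed closed_subspace)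
      finally show ?thesis .
    qed
    ultimately have "N \<in> null_sets std_gauss"
      by (intro null_sets_std_gauss_negligible)
    then show ?thesis by (intro measure_Diff_null_set[symmetric]) auto
  qed
  also have "\<dots> \<le> measure std_gauss {e. T_stat V Tn q (f + \<sigma> *\<^sub>R e) > 0}"
  proof (rule finite_measure_mono)
    show "E1 \<inter> E2 - N \<subseteq> {e. T_stat V Tn q (f + \<sigma> *\<^sub>R e) > 0}"
    proof
      fix e assume e: "e \<in> E1 \<inter> E2 - N"
      have nz: "norm (?P (f + \<sigma> *\<^sub>R e)) > 0"
        using e by (simp add: N_def perp_proj_eq_0_iff[OF V])
      have "?P (f + \<sigma> *\<^sub>R e) = \<sigma> *\<^sub>R (?P e + g)"
        using \<sigma> by (simp add: linear_add[OF lin] linear_cmul[OF lin] g_def scaleR_add_right)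
      then have n: "norm (?P (f + \<sigma> *\<^sub>R e)) = \<sigma> * norm (?P e + g)" using \<sigma> by simp
      have "norm (?P e + g) \<le> sqrt x" using e by (auto simp: E1_def intro: real_le_rsqrt)
      then have "q t * norm (?P (f + \<sigma> *\<^sub>R e)) \<le> q t * (\<sigma> * sqrt x)"
        unfolding n using q \<sigma> by (intro mult_left_mono) auto
      also have "\<dots> = ?s * ((q t * (1 / ?s) * sqrt x) * \<sigma>)" using s by simp
      also have "\<dots> < ?s * (f \<bullet> t + \<sigma> * (e \<bullet> t))"
      proof (rule mult_strict_left_mono[OF _ s])
        have "- z * \<sigma> < (e \<bullet> t) * \<sigma>" using e \<sigma> by (intro mult_strict_right_mono) (auto simp: E2_def)
        moreover have "(q t * (1 / ?s) * sqrt x) * \<sigma> + z * \<sigma> \<le> f \<bullet> t"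
          using ft unfolding Mg x_def[symmetric] z_def[symmetric] distrib_right .
        ultimately show "(q t * (1 / ?s) * sqrt x) * \<sigma> < f \<bullet> t + \<sigma> * (e \<bullet> t)"
          by (simp add: mult.commute)
      qed
      also have "f \<bullet> t + \<sigma> * (e \<bullet> t) = (f + \<sigma> *\<^sub>R e) \<bullet> t" by (simp add: inner_add_left)
      finally show "e \<in> {e. T_stat V Tn q (f + \<sigma> *\<^sub>R e) > 0}"
        using t(1) nz by (auto simp: T_stat_pos_iff pos_less_divide_eq)
    qed
    have "{e. T_stat V Tn q (f + \<sigma> *\<^sub>R e) > 0} = (\<lambda>e. f + \<sigma> *\<^sub>R e) -` {y. T_stat V Tn q y > 0}" by auto
    also have "\<dots> \<in> sets borel"
      by (intro measurable_sets_borel[where M = borel] T_stat_pos_measurable) auto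
    finally show "{e. T_stat V Tn q (f + \<sigma> *\<^sub>R e) > 0} \<in> events" by simp
  qed
  finally show ?thesis by (simp add: measure_gauss_law T_stat_pos_measurable)
qed

end

theorem theorem1:
  fixes \<alpha> :: real and p :: nat and v :: "nat \<Rightarrow> 'a::euclidean_space"
    and Tn V :: "'a set" and q :: "'a \<Rightarrow> real"
  assumes n2: "DIM('a) \<ge> 2"
    and alpha: "0 < \<alpha>" "\<alpha> < 1/2"
    and indep: "inj_on v {..<p}" "independent (v ` {..<p})"
    and Tn_fin: "finite Tn"
    and Tn_sub: "Tn \<subseteq> {t. norm t = 1 \<and> (\<exists>c::nat \<Rightarrow> real. (\<forall>j<p. c j \<ge> 0) \<and> t = (\<Sum>j<p. c j *\<^sub>R v j))}"
    and V_sub: "subspace V" and V_span: "span Tn \<subseteq> V" and V_dim: "dim V < DIM('a)"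
    and q_level: "measure std_gauss {e. T_stat V Tn q e > 0} = \<alpha>"
  shows "(SUP \<sigma>\<in>{0<..}. SUP f\<in>{f. \<forall>j<p. f \<bullet> v j \<le> 0}.
            measure (gauss_law f \<sigma>) {y. T_stat V Tn q y > 0})
           = measure (gauss_law 0 1) {y. T_stat V Tn q y > 0}
       \<and> measure (gauss_law 0 1) {y. T_stat V Tn q y > 0} = \<alpha>
       \<and> (\<forall>\<beta> f \<sigma>. 0 < \<beta> \<and> \<beta> < 1 \<and> 0 < \<sigma> \<longrightarrow>
            (\<exists>t\<in>Tn. f \<bullet> t \<ge>
               (q t * (1 / sqrt (real (DIM('a) - dim V)))
                  * sqrt (upper_quantile (nc_chi2 (DIM('a) - dim V) ((norm (f - orth_proj V f))\<^sup>2 / \<sigma>\<^sup>2)) (\<beta>/2))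
                + upper_quantile std_normal_measure (\<beta>/2)) * \<sigma>) \<longrightarrow>
            measure (gauss_law f \<sigma>) {y. T_stat V Tn q y > 0} \<ge> 1 - \<beta>)"
proof -
  interpret prob_space "std_gauss :: 'a measure" by (rule prob_space_std_gauss)
  let ?Q = "{y. T_stat V Tn q y > 0}" and ?C = "{f. \<forall>j<p. f \<bullet> v j \<le> 0}"
  \<comment> \<open>\<open>Max {}\<close> is some fixed value, so for empty \<open>Tn\<close> the
    event would not depend on \<open>e\<close> and would have probability 0 or 1, which
    \<open>0 < \<alpha> < 1/2\<close> rules out.\<close>
  have ne: "Tn \<noteq> {}"
  proof
    assume "Tn = {}"
    then have "{e. T_stat V Tn q e > 0} = {} \<or> {e. T_stat V Tn q e > 0} = UNIV"
      by (auto simp: T_stat_def)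
    then show False using q_level alpha prob_space by auto
  qed
  have TnV: "Tn \<subseteq> V" using V_span span_superset by blast
  note ctx = V_sub V_dim Tn_fin ne TnV
  have nt: "norm t = 1" if "t \<in> Tn" for t using that Tn_sub by auto
  have q: "q t > 0" if "t \<in> Tn" for t
    using q_pos_of_level_less_half[OF ctx that nt[OF that]] q_level alpha by simp
  have ft: "f \<bullet> t \<le> 0" if f: "f \<in> ?C" and t: "t \<in> Tn" for f t
  proof -
    obtain c where c: "\<forall>j<p. c j \<ge> (0::real)" "t = (\<Sum>j<p. c j *\<^sub>R v j)" using Tn_sub t by blast
    show ?thesis unfolding c(2) inner_sum_right
      using c(1) f by (intro sum_nonpos) (auto intro: mult_nonneg_nonpos)
  qed
  have le: "measure (gauss_law f \<sigma>) ?Q \<le> \<alpha>" if "f \<in> ?C" "\<sigma> > 0" for f \<sigma>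
    using T_stat_level_bound[OF ctx, of q f \<sigma>] q ft[OF that(1)] that(2) q_level by simp
  have eq: "measure (gauss_law 0 \<sigma>) ?Q = \<alpha>" if "\<sigma> > 0" for \<sigma>
    using q_level that by (simp add: measure_gauss_law T_stat_pos_measurable[OF ctx] T_stat_scale[OF ctx])
  \<comment> \<open>The supremum over the cone is a maximum, attained at its apex
    \<open>f = 0\<close>, with the same value for every \<sigma>.\<close>
  have inner: "(SUP f\<in>?C. measure (gauss_law f \<sigma>) ?Q) = \<alpha>" if "\<sigma> > 0" for \<sigma>
  proof (rule cSup_eq_maximum)
    show "\<alpha> \<in> (\<lambda>f. measure (gauss_law f \<sigma>) ?Q) ` ?C"
      using eq[OF that] by (intro image_eqI[of _ _ 0]) auto
    show "x \<le> \<alpha>" if "x \<in> (\<lambda>f. measure (gauss_law f \<sigma>) ?Q) ` ?C" for x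
      using that le \<open>\<sigma> > 0\<close> by auto
  qed
  have "(SUP \<sigma>\<in>{0<..}. SUP f\<in>?C. measure (gauss_law f \<sigma>) ?Q) = (SUP \<sigma>\<in>{(0::real)<..}. \<alpha>)"
    by (intro SUP_cong refl inner) simp
  also have "\<dots> = \<alpha>" by (intro cSUP_const) auto
  finally have sup: "(SUP \<sigma>\<in>{0<..}. SUP f\<in>?C. measure (gauss_law f \<sigma>) ?Q) = \<alpha>" .
  show ?thesis
  proof (intro conjI allI impI)
    show "(SUP \<sigma>\<in>{0<..}. SUP f\<in>?C. measure (gauss_law f \<sigma>) ?Q) = measure (gauss_law 0 1) ?Q"
      using sup eq[of 1] by simp
    show "measure (gauss_law 0 1) ?Q = \<alpha>" using eq[of 1] by simp
    fix \<beta> f \<sigma>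
    assume b: "0 < \<beta> \<and> \<beta> < 1 \<and> 0 < \<sigma>"
      and "\<exists>t\<in>Tn. f \<bullet> t \<ge>
               (q t * (1 / sqrt (real (DIM('a) - dim V)))
                  * sqrt (upper_quantile (nc_chi2 (DIM('a) - dim V) ((norm (f - orth_proj V f))\<^sup>2 / \<sigma>\<^sup>2)) (\<beta>/2))
                + upper_quantile std_normal_measure (\<beta>/2)) * \<sigma>"
    then obtain t where t: "t \<in> Tn" "f \<bullet> t \<ge>
               (q t * (1 / sqrt (real (DIM('a) - dim V)))
                  * sqrt (upper_quantile (nc_chi2 (DIM('a) - dim V) ((norm (f - orth_proj V f))\<^sup>2 / \<sigma>\<^sup>2)) (\<beta>/2))
                + upper_quantile std_normal_measure (\<beta>/2)) * \<sigma>" by blast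
    show "measure (gauss_law f \<sigma>) ?Q \<ge> 1 - \<beta>"
      using b T_stat_power_bound[OF ctx t(1) nt[OF t(1)], of q \<sigma> \<beta> f] q[OF t(1)] t(2) by simp
  qed
qed

end
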